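(* Let $(\phi,B)$ be a bounded constraint such that $\phi$ contains neither conjunctions nor universal quantifiers. If $\widehat{TC}(\phi,B)$ holds, then $TC(\phi,B)$ holds, i.e. $(\phi,B)$ is tightly consistent.
   Context: Fix a set $V$ of variables. A (quantified) constraint is a first-order formula over the reals built from atomic constraints of the forms $f<g$, $f>g$, $f\le g$, $f\ge g$ (terms built from variables in $V$ and real function symbols) using $\wedge$, $\vee$ and bounded quantifiers $\exists x\in I\;\phi$, $\forall x\in I\;\phi$ with $I$ a closed real interval; no negation symbols occur, and a literal is an atomic constraint. A variable assignment is a function $V\to\mathbb{R}$ and $[\![\phi]\!]$ is the set of variable assignments making $\phi$ true. A box assignment is a set of variable assignments of the form $\{d: d(v)\in B(v)\ \forall v\in V\}$ for a map $B$ from $V$ to closed intervals, identified with that map (the empty set is a box assignment). $B[y\mapsto I]$ is the box assignment equal to $B$ except that it assigns $I$ to $y$; $B_1\uplus B_2$ is the smallest box assignment containing both $B_1$ and $B_2$. A bounded constraint is a pair $(\phi,B)$. $TC(\phi,B)$ (tight consistency) holds iff there is no box assignment $B'\subsetneq B$ with $[\![\phi]\!]\cap B'=[\![\phi]\!]\cap B$. The lifting $\widehat{TC}$ of $TC$ (restricted to literals) is defined recursively: for a literal $\phi$, $\widehat{TC}(\phi,B)$ iff $TC(\phi,B)$; $\widehat{TC}(\phi_1\wedge\phi_2,B)$ iff $\widehat{TC}(\phi_1,B)$ and $\widehat{TC}(\phi_2,B)$; $\widehat{TC}(\phi_1\vee\phi_2,B)$ iff $B=B_1\uplus B_2$ for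 box assignments $B_1,B_2$ with $\widehat{TC}(\phi_1,B_1)$ and $\widehat{TC}(\phi_2,B_2)$; for $Q\in\{\exists,\forall\}$, $\widehat{TC}(Qy\in I'\;\phi',B)$ iff $\widehat{TC}(\phi',B[y\mapsto I'])$. *)

theory Defs
  imports "HOL-Analysis.Analysis"
begin

type_synonym 'v assignment = "'v \<Rightarrow> real"

(* A function symbol of arity n is one that is only applied to argument lists of length n;
   what its interpretation does on lists of other lengths is irrelevant. *)
datatype ('f, 'v) rterm = Var 'v | Fun 'f "('f, 'v) rterm list"

datatype relsym = Lt | Gt | Le | Ge

datatype ('f, 'v) constraint =
    Atom relsym "('f, 'v) rterm" "('f, 'v) rterm"
  | Conj "('f, 'v) constraint" "('f, 'v) constraint"
  | Disj "('f, 'v) constraint" "('f, 'v) constraint"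
  | Exists 'v "real set" "('f, 'v) constraint"
  | Forall 'v "real set" "('f, 'v) constraint"

(* Intervals are nonempty and may be unbounded. Empty quantification ranges have to be excluded:
   over an empty range an existential constraint is false, whereas its body is vacuously
   consistent with the (empty) updated box. *)
definition closed_interval :: "real set \<Rightarrow> bool" where
  "closed_interval I \<longleftrightarrow> I \<noteq> {} \<and> closed I \<and> is_interval I"

primrec wf_constraint :: "('f, 'v) constraint \<Rightarrow> bool" where
  "wf_constraint (Atom r s t) \<longleftrightarrow> True"
| "wf_constraint (Conj \<phi> \<psi>) \<longleftrightarrow> wf_constraint \<phi> \<and> wf_constraint \<psi>"
| "wf_constraint (Disj \<phi> \<psi>) \<longleftrightarrow> wf_constraint \<phi> \<and> wf_constraint \<psi>"
| "wf_constraint (Exists y I \<phi>) \<longleftrightarrow> closed_interval I \<and> wf_constraint \<phi>"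
| "wf_constraint (Forall y I \<phi>) \<longleftrightarrow> closed_interval I \<and> wf_constraint \<phi>"

primrec conj_free :: "('f, 'v) constraint \<Rightarrow> bool" where
  "conj_free (Atom r s t) \<longleftrightarrow> True"
| "conj_free (Conj \<phi> \<psi>) \<longleftrightarrow> False"
| "conj_free (Disj \<phi> \<psi>) \<longleftrightarrow> conj_free \<phi> \<and> conj_free \<psi>"
| "conj_free (Exists y I \<phi>) \<longleftrightarrow> conj_free \<phi>"
| "conj_free (Forall y I \<phi>) \<longleftrightarrow> conj_free \<phi>"

primrec forall_free :: "('f, 'v) constraint \<Rightarrow> bool" where
  "forall_free (Atom r s t) \<longleftrightarrow> True"
| "forall_free (Conj \<phi> \<psi>) \<longleftrightarrow> forall_free \<phi> \<and> forall_free \<psi>"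
| "forall_free (Disj \<phi> \<psi>) \<longleftrightarrow> forall_free \<phi> \<and> forall_free \<psi>"
| "forall_free (Exists y I \<phi>) \<longleftrightarrow> forall_free \<phi>"
| "forall_free (Forall y I \<phi>) \<longleftrightarrow> False"

primrec eval_rterm :: "('f \<Rightarrow> real list \<Rightarrow> real) \<Rightarrow> 'v assignment \<Rightarrow> ('f, 'v) rterm \<Rightarrow> real" where
  "eval_rterm F d (Var v) = d v"
| "eval_rterm F d (Fun f ts) = F f (map (eval_rterm F d) ts)"

primrec rel_holds :: "relsym \<Rightarrow> real \<Rightarrow> real \<Rightarrow> bool" where
  "rel_holds Lt a b \<longleftrightarrow> a < b"
| "rel_holds Gt a b \<longleftrightarrow> a > b"
| "rel_holds Le a b \<longleftrightarrow> a \<le> b"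
| "rel_holds Ge a b \<longleftrightarrow> a \<ge> b"

primrec satisfies :: "('f \<Rightarrow> real list \<Rightarrow> real) \<Rightarrow> 'v assignment \<Rightarrow> ('f, 'v) constraint \<Rightarrow> bool" where
  "satisfies F d (Atom r s t) \<longleftrightarrow> rel_holds r (eval_rterm F d s) (eval_rterm F d t)"
| "satisfies F d (Conj \<phi> \<psi>) \<longleftrightarrow> satisfies F d \<phi> \<and> satisfies F d \<psi>"
| "satisfies F d (Disj \<phi> \<psi>) \<longleftrightarrow> satisfies F d \<phi> \<or> satisfies F d \<psi>"
| "satisfies F d (Exists y I \<phi>) \<longleftrightarrow> (\<exists>c\<in>I. satisfies F (d(y := c)) \<phi>)"
| "satisfies F d (Forall y I \<phi>) \<longleftrightarrow> (\<forall>c\<in>I. satisfies F (d(y := c)) \<phi>)"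

definition solutions :: "('f \<Rightarrow> real list \<Rightarrow> real) \<Rightarrow> ('f, 'v) constraint \<Rightarrow> 'v assignment set" where
  "solutions F \<phi> = {d. satisfies F d \<phi>}"

definition box_of :: "('v \<Rightarrow> real set) \<Rightarrow> 'v assignment set" where
  "box_of B = {d. \<forall>v. d v \<in> B v}"

definition box_assignment :: "'v assignment set \<Rightarrow> bool" where
  "box_assignment S \<longleftrightarrow> S = {} \<or> (\<exists>B. (\<forall>v. closed_interval (B v)) \<and> S = box_of B)"

(* Boxes are kept as sets of assignments, so the update is a set operation. It agrees with
   updating the underlying map (lemma box_update_box_of) and leaves the empty box empty. *)
definition box_update :: "'v assignment set \<Rightarrow> 'v \<Rightarrow> real set \<Rightarrow> 'v assignment set" where
  "box_update S y I = {d(y := c) | d c. d \<in> S \<and> c \<in> I}"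

definition box_join :: "'v assignment set \<Rightarrow> 'v assignment set \<Rightarrow> 'v assignment set" where
  "box_join S T = (LEAST U. box_assignment U \<and> S \<subseteq> U \<and> T \<subseteq> U)"

definition TC :: "('f \<Rightarrow> real list \<Rightarrow> real) \<Rightarrow> ('f, 'v) constraint \<Rightarrow> 'v assignment set \<Rightarrow> bool" where
  "TC F \<phi> B \<longleftrightarrow>
     \<not> (\<exists>B'. box_assignment B' \<and> B' \<subset> B \<and> solutions F \<phi> \<inter> B' = solutions F \<phi> \<inter> B)"

primrec TC_hat :: "('f \<Rightarrow> real list \<Rightarrow> real) \<Rightarrow> ('f, 'v) constraint \<Rightarrow> 'v assignment set \<Rightarrow> bool" where
  "TC_hat F (Atom r s t) B \<longleftrightarrow> TC F (Atom r s t) B"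
| "TC_hat F (Conj \<phi> \<psi>) B \<longleftrightarrow> TC_hat F \<phi> B \<and> TC_hat F \<psi> B"
| "TC_hat F (Disj \<phi> \<psi>) B \<longleftrightarrow>
     (\<exists>B1 B2. box_assignment B1 \<and> box_assignment B2 \<and> B = box_join B1 B2 \<and>
        TC_hat F \<phi> B1 \<and> TC_hat F \<psi> B2)"
| "TC_hat F (Exists y I \<phi>) B \<longleftrightarrow> TC_hat F \<phi> (box_update B y I)"
| "TC_hat F (Forall y I \<phi>) B \<longleftrightarrow> TC_hat F \<phi> (box_update B y I)"

lemma box_update_box_of:
  assumes "\<And>v. B v \<noteq> {}"
  shows "box_update (box_of B) y I = box_of (B(y := I))"
proof
  show "box_update (box_of B) y I \<subseteq> box_of (B(y := I))"
    by (auto simp: box_update_def box_of_def)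
  show "box_of (B(y := I)) \<subseteq> box_update (box_of B) y I"
  proof
    fix d assume d: "d \<in> box_of (B(y := I))"
    obtain b where b: "b \<in> B y" using assms by blast
    have "d(y := b) \<in> box_of B" using d b by (auto simp: box_of_def split: if_splits)
    moreover have "d y \<in> I" using d by (auto simp: box_of_def split: if_splits)
    moreover have "d = (d(y := b))(y := d y)" by simp
    ultimately show "d \<in> box_update (box_of B) y I"
      unfolding box_update_def by blast
  qed
qed

lemma box_assignment_Inter:
  assumes "\<And>U. U \<in> \<U> \<Longrightarrow> box_assignment U" and "\<U> \<noteq> {}"
  shows "box_assignment (\<Inter>\<U>)"
proof (cases "\<Inter>\<U> = {}")
  case True
  then show ?thesis by (simp add: box_assignment_def)
next
  case False
  then obtain d where d: "\<And>U. U \<in> \<U> \<Longrightarrow> d \<in> U" by auto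
  have "\<forall>U\<in>\<U>. \<exists>B. (\<forall>v. closed_interval (B v)) \<and> U = box_of B"
  proof
    fix U assume "U \<in> \<U>"
    then show "\<exists>B. (\<forall>v. closed_interval (B v)) \<and> U = box_of B"
      using assms(1)[of U] d[of U] unfolding box_assignment_def by blast
  qed
  from bchoice[OF this] obtain B where
    B: "\<forall>U\<in>\<U>. (\<forall>v. closed_interval (B U v)) \<and> U = box_of (B U)" ..
  define C where "C = (\<lambda>v. \<Inter>U\<in>\<U>. B U v)"
  have mem: "x \<in> U \<longleftrightarrow> (\<forall>v. x v \<in> B U v)" if "U \<in> \<U>" for x U
  proof -
    have "U = box_of (B U)" using B that by blast
    then have "x \<in> U \<longleftrightarrow> x \<in> box_of (B U)" by (rule arg_cong)
    then show ?thesis by (simp only: box_of_def mem_Collect_eq)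
  qed
  have "closed_interval (C v)" for v
    unfolding closed_interval_def
  proof (intro conjI)
    have "d v \<in> C v" using d mem by (simp add: C_def)
    then show "C v \<noteq> {}" by blast
    have "closed (B U v)" if "U \<in> \<U>" for U
      using B that unfolding closed_interval_def by blast
    then show "closed (C v)" unfolding C_def by (intro closed_INT) blast
    show "is_interval (C v)"
      unfolding is_interval_1
    proof (intro ballI allI impI)
      fix a b x assume ab: "a \<in> C v" "b \<in> C v" "a \<le> x \<and> x \<le> b"
      have "x \<in> B U v" if U: "U \<in> \<U>" for U
      proof -
        have "is_interval (B U v)" using B U unfolding closed_interval_def by blast
        moreover have "a \<in> B U v" "b \<in> B U v" using ab U unfolding C_def by blast+
        ultimately show ?thesis using ab(3) unfolding is_interval_1 by blast
      qed
      then show "x \<in> C v" unfolding C_def by blast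
    qed
  qed
  moreover have "\<Inter>\<U> = box_of C"
  proof (rule set_eqI)
    fix x
    have "x \<in> \<Inter>\<U> \<longleftrightarrow> (\<forall>U\<in>\<U>. \<forall>v. x v \<in> B U v)" using mem by simp
    also have "\<dots> \<longleftrightarrow> x \<in> box_of C" unfolding C_def box_of_def by blast
    finally show "x \<in> \<Inter>\<U> \<longleftrightarrow> x \<in> box_of C" .
  qed
  ultimately show ?thesis unfolding box_assignment_def by blast
qed

lemma box_assignment_UNIV: "box_assignment UNIV"
  unfolding box_assignment_def
  by (intro disjI2 exI[of _ "\<lambda>_. UNIV"]) (auto simp: box_of_def closed_interval_def)

(* The least box containing two given ones exists, so LEAST in box_join is well defined. *)
lemma box_join_least:
  shows "box_assignment (box_join S T)" and "S \<subseteq> box_join S T" and "T \<subseteq> box_join S T"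
    and "\<And>U. box_assignment U \<Longrightarrow> S \<subseteq> U \<Longrightarrow> T \<subseteq> U \<Longrightarrow> box_join S T \<subseteq> U"
proof -
  let ?\<U> = "{U. box_assignment U \<and> S \<subseteq> U \<and> T \<subseteq> U}"
  have "box_assignment (\<Inter>?\<U>)"
    by (rule box_assignment_Inter) (use box_assignment_UNIV in auto)
  then have eq: "box_join S T = \<Inter>?\<U>"
    unfolding box_join_def by (intro Least_equality) auto
  show "box_assignment (box_join S T)" unfolding eq by fact
  show "S \<subseteq> box_join S T" "T \<subseteq> box_join S T" unfolding eq by auto
  show "\<And>U. box_assignment U \<Longrightarrow> S \<subseteq> U \<Longrightarrow> T \<subseteq> U \<Longrightarrow> box_join S T \<subseteq> U"
    unfolding eq by auto
qed

end

theory Submission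
  imports Defs
begin

text \<open>Tight consistency of \<open>(\<phi>, B)\<close> says that \<open>B\<close> is contained in every box containing the solutions
  of \<open>\<phi>\<close> in \<open>B\<close>. In this form it passes to disjunctions because the join is the least
  upper bound. For an existential quantifier over \<open>y\<close>, the truth of the constraint does not depend on
  the value of \<open>y\<close>, so a single solution yields the whole \<open>y\<close>-extent of \<open>B\<close>,
  while all other coordinates are controlled by the tight consistency of the body.\<close>

lemma box_assignment_Int:
  assumes "box_assignment S" "box_assignment T"
  shows "box_assignment (S \<inter> T)"
  using box_assignment_Inter[of "{S, T}"] assms by auto

lemma box_assignment_empty: "box_assignment {}"
  by (simp add: box_assignment_def)

text \<open>Boxes are closed under intersection, so for a box \<open>U\<close> containing the
  solutions in \<open>B\<close>, \<open>U \<inter> B\<close> competes with \<open>B\<close> in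
  \<open>TC\<close>. Conversely, a competing \<open>B'\<close> is itself such a
  \<open>U\<close>.\<close>

lemma TC_iff_least:
  assumes "box_assignment B"
  shows "TC F \<phi> B \<longleftrightarrow> (\<forall>U. box_assignment U \<longrightarrow> solutions F \<phi> \<inter> B \<subseteq> U \<longrightarrow> B \<subseteq> U)"
proof
  assume tc: "TC F \<phi> B"
  show "\<forall>U. box_assignment U \<longrightarrow> solutions F \<phi> \<inter> B \<subseteq> U \<longrightarrow> B \<subseteq> U"
  proof (intro allI impI)
    fix U assume U: "box_assignment U" "solutions F \<phi> \<inter> B \<subseteq> U"
    have "box_assignment (U \<inter> B)"
      using U(1) assms by (rule box_assignment_Int)
    moreover have "solutions F \<phi> \<inter> (U \<inter> B) = solutions F \<phi> \<inter> B"
      using U(2) by blast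
    ultimately have "\<not> U \<inter> B \<subset> B"
      using tc unfolding TC_def by blast
    then show "B \<subseteq> U" by blast
  qed
next
  assume "\<forall>U. box_assignment U \<longrightarrow> solutions F \<phi> \<inter> B \<subseteq> U \<longrightarrow> B \<subseteq> U"
  then show "TC F \<phi> B"
    unfolding TC_def by blast
qed

lemma box_assignment_cases:
  assumes "box_assignment S"
  obtains "S = {}" | C where "\<And>v. closed_interval (C v)" "S = box_of C"
  using assms unfolding box_assignment_def by blast

lemma box_assignment_update:
  assumes "box_assignment S" "closed_interval I"
  shows "box_assignment (box_update S y I)"
  using assms(1)
proof (cases rule: box_assignment_cases)
  case 1
  then show ?thesis by (simp add: box_update_def box_assignment_empty)
next
  case (2 C)
  have "box_update S y I = box_of (C(y := I))"
    using 2 by (simp add: box_update_box_of closed_interval_def)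
  moreover have "closed_interval ((C(y := I)) v)" for v
    using 2(1) assms(2) by simp
  ultimately show ?thesis
    unfolding box_assignment_def by blast
qed

text \<open>Boxes are products, so one coordinate can be exchanged independently of the
  others.\<close>

lemma box_assignment_mix:
  assumes "box_assignment S" "d \<in> S" "e \<in> S"
  shows "d(y := e y) \<in> S"
  using assms(1)
proof (cases rule: box_assignment_cases)
  case 1
  then show ?thesis using assms(2) by simp
next
  case (2 C)
  then show ?thesis using assms(2,3) by (simp add: box_of_def)
qed

lemma TC_Disj:
  assumes "box_assignment B1" "box_assignment B2" "TC F \<phi> B1" "TC F \<psi> B2"
  shows "TC F (Disj \<phi> \<psi>) (box_join B1 B2)"
proof -
  note J = box_join_least[where S = B1 and T = B2]
  show ?thesis
    unfolding TC_iff_least[OF J(1)]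
  proof (intro allI impI)
    fix U assume U: "box_assignment U" "solutions F (Disj \<phi> \<psi>) \<inter> box_join B1 B2 \<subseteq> U"
    have "solutions F \<phi> \<inter> B1 \<subseteq> U" "solutions F \<psi> \<inter> B2 \<subseteq> U"
      using U(2) J(2,3) by (auto simp: solutions_def)
    then have "B1 \<subseteq> U" "B2 \<subseteq> U"
      using assms U(1) by (simp_all add: TC_iff_least)
    then show "box_join B1 B2 \<subseteq> U"
      using J(4) U(1) by blast
  qed
qed

lemma TC_Exists:
  assumes B: "box_assignment B" and I: "closed_interval I"
    and tc: "TC F \<phi> (box_update B y I)"
  shows "TC F (Exists y I \<phi>) B"
  unfolding TC_iff_least[OF B]
proof (intro allI impI subsetI)
  fix U d assume U: "box_assignment U" "solutions F (Exists y I \<phi>) \<inter> B \<subseteq> U" and d: "d \<in> B"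
  have least: "box_update B y I \<subseteq> W"
    if "box_assignment W" "solutions F \<phi> \<inter> box_update B y I \<subseteq> W" for W
    using tc that by (simp add: TC_iff_least box_assignment_update[OF B I])
  obtain c where c: "c \<in> I" using I by (auto simp: closed_interval_def)
  have dc: "d(y := c) \<in> box_update B y I"
    using d c by (auto simp: box_update_def)
  have U_mem: "e \<in> U" if "e \<in> B" "a \<in> I" "satisfies F (e(y := a)) \<phi>" for e a
    using U(2) that by (auto simp: solutions_def)
  \<comment> \<open>Otherwise the empty box would contain all these solutions, hence also
    \<open>d(y := c)\<close>.\<close>
  have "solutions F \<phi> \<inter> box_update B y I \<noteq> {}"
    using least[OF box_assignment_empty] dc by blast
  then obtain e a where e: "e \<in> B" "a \<in> I" "satisfies F (e(y := a)) \<phi>"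
    by (auto simp: solutions_def box_update_def)
  \<comment> \<open>The witness \<open>a\<close> overwrites the value at \<open>y\<close>, so that
    value can be changed to \<open>d y\<close> freely within \<open>B\<close>.\<close>
  have "e(y := d y) \<in> U"
    using box_assignment_mix[OF B e(1) d] e by (intro U_mem[of _ a]) auto
  \<comment> \<open>Comparing with the box \<open>box_update U y I\<close> yields a point
    \<open>d'\<close> of \<open>U\<close> that agrees with \<open>d\<close> except possibly at
    \<open>y\<close>.\<close>
  moreover have "solutions F \<phi> \<inter> box_update B y I \<subseteq> box_update U y I"
    using U_mem by (fastforce simp: solutions_def box_update_def)
  then have "d(y := c) \<in> box_update U y I"
    using least[OF box_assignment_update[OF U(1) I]] dc by blast
  then obtain d' c' where d': "d' \<in> U" "d(y := c) = d'(y := c')"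
    by (auto simp: box_update_def)
  \<comment> \<open>\<open>e(y := d y)\<close> supplies the missing coordinate at
    \<open>y\<close>.\<close>
  ultimately have "d'(y := d y) \<in> U"
    using box_assignment_mix[OF U(1), of d' "e(y := d y)" y] by simp
  moreover have "d'(y := d y) = d"
    using d'(2) by (metis fun_upd_triv fun_upd_upd)
  ultimately show "d \<in> U" by simp
qed

theorem theorem3:
  fixes F :: "'f \<Rightarrow> real list \<Rightarrow> real"
    and \<phi> :: "('f, 'v) constraint"
    and B :: "'v assignment set"
  assumes "wf_constraint \<phi>"
    and "box_assignment B"
    and "conj_free \<phi>"
    and "forall_free \<phi>"
    and "TC_hat F \<phi> B"
  shows "TC F \<phi> B"
  using assms
\<comment> \<open>\<open>B\<close> must vary, since disjunctions split it and quantifiers update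
  it.\<close>
proof (induction \<phi> arbitrary: B)
  case (Disj \<phi> \<psi>)
  then show ?case by (auto intro!: TC_Disj)
next
  case (Exists y I \<phi>)
  then show ?case by (auto intro!: TC_Exists box_assignment_update)
qed simp_all

end
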